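(* Let $m\ge 3$ be an integer, $n=2^m-3$, and let $C_1\subset V(H^n)$ be a binary code of length $n$, cardinality $2^{n-m}$ and code distance $3$ (i.e. a $(2^m-3,2^{n-m},3)$ code). Define $$C_2=\{\bar x\in V(H^n)\mid \bar x+\bar 1\in C_1\},\qquad C_3=\{\bar x\in V(H^n)\mid d(\bar x,C_1)=1\}\setminus C_2,\qquad C_4=V(H^n)\setminus(C_1\cup C_2\cup C_3).$$ Then $\{C_1,C_2,C_3,C_4\}$ is a partition of $V(H^n)$ and it is equitable with parameters $$(S_{ij})_{i,j=1}^4=\left(\begin{array}{cccc}0&1&n-1&0\\1&0&n-1&0\\1&1&n-4&2\\0&0&n-1&1\end{array}\right).$$
   Context: $H^n$ is the graph (hypercube) whose vertex set $V(H^n)$ is the set of all binary words of length $n$, two words being adjacent iff they differ in exactly one position. $d(\cdot,\cdot)$ is the Hamming distance, and $d(\bar x,C)=\min_{\bar y\in C}d(\bar x,\bar y)$. $\bar 1=1\ldots1$ is the all-one word and addition of words is coordinatewise modulo $2$. An $(n,|C|,d)$ code is a subset $C\subset V(H^n)$ such that $d(\bar x,\bar y)\ge d$ for any two different $\bar x,\bar y\in C$. A partition $\{C_1,\ldots,C_r\}$ of $V(H^n)$ into $r$ nonempty parts is equitable with parameters $(S_{ij})_{i,j=1}^r$ if for every $i,j\in\{1,\ldots,r\}$ every vertex $\bar x\in C_i$ has exactly $S_{ij}$ neighbors in $C_j$. *)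

theory Defs
  imports Main "HOL-Library.Z2" "HOL-Library.Disjoint_Sets"
begin

type_synonym binary_word = "bit list"

definition words :: "nat \<Rightarrow> binary_word set" where
  "words n = {x. length x = n}"

definition hamming :: "binary_word \<Rightarrow> binary_word \<Rightarrow> nat" where
  "hamming x y = card {i. i < length x \<and> x ! i \<noteq> y ! i}"

definition hypercube_adj :: "nat \<Rightarrow> binary_word \<Rightarrow> binary_word \<Rightarrow> bool" where
  "hypercube_adj n x y \<longleftrightarrow> x \<in> words n \<and> y \<in> words n \<and> hamming x y = 1"

text \<open>Only meaningful for nonempty codes: \<^const>\<open>Min\<close> is unspecified on the empty set.\<close>

definition dist_to_code :: "binary_word \<Rightarrow> binary_word set \<Rightarrow> nat" where
  "dist_to_code x C = Min (hamming x ` C)"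

definition word_add :: "binary_word \<Rightarrow> binary_word \<Rightarrow> binary_word" where
  "word_add x y = map2 (+) x y"

definition all_one :: "nat \<Rightarrow> binary_word" where
  "all_one n = replicate n 1"

text \<open>An $(n,M,d)$ code; the distance between different codewords is at least \<open>d\<close>,
  and \<open>d\<close> need not be attained.\<close>

definition is_code :: "nat \<Rightarrow> nat \<Rightarrow> nat \<Rightarrow> binary_word set \<Rightarrow> bool" where
  "is_code n M d C \<longleftrightarrow>
     C \<subseteq> words n \<and> card C = M \<and> (\<forall>x\<in>C. \<forall>y\<in>C. x \<noteq> y \<longrightarrow> d \<le> hamming x y)"

text \<open>The parts are listed in order, so that \<open>S\<close> (a list of rows) can refer to them by
  index, starting from 0. Nonemptiness of the parts is a component of \<^const>\<open>partition_on\<close>;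
  distinctness ensures that parts with different indices are different, hence disjoint.\<close>

definition equitable_partition ::
    "'a set \<Rightarrow> ('a \<Rightarrow> 'a \<Rightarrow> bool) \<Rightarrow> 'a set list \<Rightarrow> nat list list \<Rightarrow> bool" where
  "equitable_partition V adj Cs S \<longleftrightarrow>
     partition_on V (set Cs) \<and> distinct Cs \<and>
     length S = length Cs \<and> (\<forall>row\<in>set S. length row = length Cs) \<and>
     (\<forall>i<length Cs. \<forall>j<length Cs. \<forall>x\<in>Cs ! i. card {y \<in> Cs ! j. adj x y} = S ! i ! j)"

end

theory Submission
  imports Defs "HOL-Library.Indicator_Function"
begin

text \<open>
  Let \<open>A\<close> be the adjacency operator of the hypercube acting on real functions of words,
  \<open>T = A + I\<close> the operator that sums a function over balls of radius 1, \<open>P\<close> the operator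
  \<open>(P h) x = h (x + 1\<dots>1)\<close>, and \<open>f\<close> the indicator of the code \<open>C\<^sub>1\<close>, so that \<open>P f\<close> is the
  indicator of \<open>C\<^sub>2\<close>. Everything follows from two identities,
    \<open>T\<^sup>2 f = 2 f + 2 P f + (n - 1)\<close> and \<open>T (P f) = T f\<close>.
  Distance 3 makes \<open>T f\<close> the indicator of the union of the balls of radius 1 around codewords.
  By the second identity these balls cover \<open>C\<^sub>2\<close>, so \<open>C\<^sub>4\<close> is the set where \<open>T f\<close> vanishes.
  Applying \<open>T\<close> to the indicators \<open>f\<close>, \<open>P f\<close> and \<open>1 - T f\<close> and evaluating by the two identities gives all neighbour counts.

  The identities come from a linear programming bound that the code attains. The characters
  of the group of words are common eigenfunctions: for the character indexed by a word of
  weight \<open>k\<close>, the eigenvalue of \<open>T\<close> is \<open>u = n + 1 - 2 k\<close> and that of \<open>P\<close> is \<open>(-1)\<^sup>k\<close>. Hence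
  \<open>Q = T\<^sup>2 - 2 - 2 P\<close> has eigenvalue \<open>u\<^sup>2 - 4\<close> for even \<open>k\<close> and \<open>u\<^sup>2\<close> for odd \<open>k\<close>. Since 4 divides
  \<open>n + 3\<close>, the number \<open>u\<close> is congruent to 2 modulo 4 when \<open>k\<close> is even, so no eigenvalue of
  \<open>Q\<close> is negative (\<open>defect_nonneg\<close>). On the other hand \<open>(Q f) c \<le> n - 1\<close> at each codeword \<open>c\<close>, so
  the inner product of \<open>f\<close> and \<open>Q f\<close> is at most \<open>\<bar>C\<^sub>1\<bar> (n - 1)\<close>, and for
  \<open>\<bar>C\<^sub>1\<bar> = 2\<^sup>n / (n + 3)\<close> the trivial character alone already contributes this much. All other
  contributions are zero (\<open>spectral_support\<close>): only characters with \<open>u = \<plusminus>2\<close>, \<open>k\<close> even, or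
  \<open>u = 0\<close>, \<open>k\<close> odd, occur in \<open>f\<close> besides the trivial one. On these \<open>Q\<close> vanishes, so \<open>Q f\<close> is
  the constant \<open>n - 1\<close>, which is the first identity; on these and on the trivial one
  \<open>T P\<close> and \<open>T\<close> agree, which is the second.
\<close>

section \<open>Words, flips and neighbours\<close>

definition flip :: "nat \<Rightarrow> binary_word \<Rightarrow> binary_word" where
  "flip i x = x[i := x ! i + 1]"

text \<open>The operator \<open>T = A + I\<close>. Adding the identity to the adjacency operator makes the sum at a point
  count the codewords in a ball, and makes the odd spectrum of \<open>A\<close> even for odd \<open>n\<close>.\<close>

definition ball_sum :: "nat \<Rightarrow> (binary_word \<Rightarrow> real) \<Rightarrow> binary_word \<Rightarrow> real" where
  "ball_sum n f x = f x + (\<Sum>i<n. f (flip i x))"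

definition sign :: "bit \<Rightarrow> real" where
  "sign b = (if b = 1 then -1 else 1)"

text \<open>The real characters of the elementary abelian 2-group of words of length \<open>n\<close>: the value is
  \<open>-1\<close> to the power of the inner product of \<open>w\<close> and \<open>x\<close>.\<close>

definition character :: "nat \<Rightarrow> binary_word \<Rightarrow> binary_word \<Rightarrow> real" where
  "character n w x = (\<Prod>i<n. sign (w ! i * x ! i))"

definition weight :: "binary_word \<Rightarrow> nat" where
  "weight w = card {i. i < length w \<and> w ! i = 1}"

text \<open>These default rewrite rules turn sums and products of bits into bitwise operations, which hides
  the field structure used below.\<close>

declare add_bit_eq_xor [simp del] mult_bit_eq_and [simp del]

lemma bit_eq_add_one_iff: "a = b + 1 \<longleftrightarrow> a \<noteq> (b :: bit)"
  by (cases a; cases b) auto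

lemma flip_in_words [simp]: "flip i x \<in> words n \<longleftrightarrow> x \<in> words n"
  by (simp add: flip_def words_def)

lemma length_flip [simp]: "length (flip i x) = length x"
  by (simp add: flip_def)

lemma nth_flip: "j < length x \<Longrightarrow> flip i x ! j = (if i = j then x ! j + 1 else x ! j)"
  by (simp add: flip_def nth_list_update)

lemma flip_flip [simp]: "flip i (flip i x) = x"
  by (rule nth_equalityI) (auto simp: nth_flip add.assoc)

lemma complement_in_words [simp]: "x \<in> words n \<Longrightarrow> word_add x (all_one n) \<in> words n"
  by (simp add: words_def word_add_def all_one_def)

lemma nth_complement:
  "x \<in> words n \<Longrightarrow> i < n \<Longrightarrow> word_add x (all_one n) ! i = x ! i + 1"
  by (simp add: words_def word_add_def all_one_def)

lemma finite_words [simp]: "finite (words n)"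
  and card_words: "card (words n) = 2 ^ n"
proof -
  have U: "(UNIV :: bit set) = {0, 1}"
    by (auto intro: bit.exhaust)
  have fin: "finite (UNIV :: bit set)" by (simp add: U)
  have W: "words n = {xs. set xs \<subseteq> (UNIV :: bit set) \<and> length xs = n}"
    by (simp add: words_def)
  show "finite (words n)" unfolding W by (rule finite_lists_length_eq[OF fin])
  have "card (UNIV :: bit set) = 2" by (simp add: U)
  then show "card (words n) = 2 ^ n" unfolding W using card_lists_length_eq[OF fin, of n] by simp
qed

lemma hamming_eq_0_iff:
  assumes "x \<in> words n" "y \<in> words n"
  shows "hamming x y = 0 \<longleftrightarrow> x = y"
  using assms by (auto simp: hamming_def words_def list_eq_iff_nth_eq)

lemma hamming_eq_1_iff:
  assumes "x \<in> words n" "y \<in> words n"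
  shows "hamming x y = 1 \<longleftrightarrow> (\<exists>i<n. y = flip i x)"
proof
  assume "hamming x y = 1"
  then obtain i where i: "{i. i < length x \<and> x ! i \<noteq> y ! i} = {i}"
    unfolding hamming_def using card_1_singletonE by metis
  have differ: "k < length x \<and> x ! k \<noteq> y ! k \<longleftrightarrow> k = i" for k
    using i by blast
  have "i < n" using differ[of i] assms(1) by (auto simp: words_def)
  moreover have "y = flip i x"
  proof (rule nth_equalityI)
    show "length y = length (flip i x)" using assms by (simp add: words_def)
    fix j assume "j < length y"
    then have "j < length x" using assms by (simp add: words_def)
    then show "y ! j = flip i x ! j"
      using differ[of j] by (auto simp: nth_flip bit_eq_add_one_iff)
  qed
  ultimately show "\<exists>i<n. y = flip i x" by blast
next
  assume "\<exists>i<n. y = flip i x"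
  then obtain i where "i < n" "y = flip i x" by blast
  then have "{j. j < length x \<and> x ! j \<noteq> y ! j} = {i}"
    using assms by (auto simp: words_def nth_flip split: if_splits)
  then show "hamming x y = 1" by (simp add: hamming_def)
qed

lemma hamming_flip_flip_le: "hamming (flip i x) (flip j x) \<le> 2"
proof -
  have "{k. k < length x \<and> flip i x ! k \<noteq> flip j x ! k} \<subseteq> {i, j}"
    by (auto simp: nth_flip split: if_splits)
  then have "hamming (flip i x) (flip j x) \<le> card {i, j}"
    unfolding hamming_def length_flip by (intro card_mono) auto
  also have "\<dots> \<le> 2" by (simp add: card_insert_if)
  finally show ?thesis .
qed

lemma flip_inj:
  assumes "x \<in> words n" "i < n" "flip i x = flip j x"
  shows "i = j"
proof (rule ccontr)
  assume "i \<noteq> j"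
  moreover have "flip i x ! i = flip j x ! i" by (simp add: assms(3))
  ultimately show False using assms(1,2) by (simp add: nth_flip words_def)
qed

lemma neighbours_eq:
  assumes "x \<in> words n"
  shows "{y \<in> S. hypercube_adj n x y} = S \<inter> (\<lambda>i. flip i x) ` {..<n}"
  using assms hamming_eq_1_iff[OF assms] by (auto simp: hypercube_adj_def)

lemma card_neighbours:
  assumes "x \<in> words n"
  shows "real (card {y \<in> S. hypercube_adj n x y}) = (\<Sum>i<n. indicator S (flip i x))"
proof -
  have inj: "inj_on (\<lambda>i. flip i x) {..<n}"
    using flip_inj[OF assms] by (auto intro: inj_onI)
  have "{y \<in> S. hypercube_adj n x y} = (\<lambda>i. flip i x) ` {i. i < n \<and> flip i x \<in> S}"
    by (auto simp: neighbours_eq[OF assms])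
  moreover have "card ((\<lambda>i. flip i x) ` {i. i < n \<and> flip i x \<in> S}) = card {i. i < n \<and> flip i x \<in> S}"
    by (rule card_image) (rule inj_on_subset[OF inj], auto)
  moreover have "(\<Sum>i<n. indicator S (flip i x)) = real (card ({..<n} \<inter> {i. flip i x \<in> S}))"
    by (simp add: indicator_def sum.If_cases)
  moreover have "{..<n} \<inter> {i. flip i x \<in> S} = {i. i < n \<and> flip i x \<in> S}" by auto
  ultimately show ?thesis by simp
qed

lemma ball_sum_indicator:
  "x \<in> words n \<Longrightarrow>
    ball_sum n (indicator S) x = indicator S x + real (card {y \<in> S. hypercube_adj n x y})"
  by (simp add: ball_sum_def card_neighbours)

lemma ball_sum_cong:
  assumes "x \<in> words n" "\<And>y. y \<in> words n \<Longrightarrow> f y = g y"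
  shows "ball_sum n f x = ball_sum n g x"
  using assms by (simp add: ball_sum_def)

section \<open>Characters of the hypercube\<close>

lemma sign_add: "sign (a + b) = sign a * sign b"
  by (cases a; cases b) (auto simp: sign_def)

lemma sign_mult_self [simp]: "sign a * sign a = 1"
  by (simp add: sign_def)

lemma character_commute: "character n w x = character n x w"
  by (simp add: character_def mult.commute)

lemma character_mult_self [simp]: "character n w x * character n w x = 1"
  by (simp add: character_def flip: prod.distrib)

lemma character_flip:
  assumes "x \<in> words n" "i < n"
  shows "character n w (flip i x) = sign (w ! i) * character n w x"
proof -
  have "character n w (flip i x)
      = (\<Prod>j<n. (if i = j then sign (w ! j) else 1) * sign (w ! j * x ! j))"
    unfolding character_def using assms
    by (intro prod.cong) (auto simp: nth_flip words_def distrib_left sign_add)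
  also have "\<dots> = sign (w ! i) * character n w x"
    using assms by (simp add: prod.distrib character_def)
  finally show ?thesis .
qed

lemma prod_sign: "w \<in> words n \<Longrightarrow> (\<Prod>i<n. sign (w ! i)) = (-1) ^ weight w"
  and sum_sign: "w \<in> words n \<Longrightarrow> (\<Sum>i<n. sign (w ! i)) = real n - 2 * real (weight w)"
proof -
  assume w: "w \<in> words n"
  have wt: "weight w = card ({..<n} \<inter> {i. w ! i = 1})"
    using w by (auto simp: weight_def words_def intro!: arg_cong[where f = card])
  show "(\<Prod>i<n. sign (w ! i)) = (-1) ^ weight w"
    by (simp add: sign_def prod.If_cases wt)
  have "(\<Sum>i<n. sign (w ! i)) = (\<Sum>i<n. 1 - 2 * (if w ! i = 1 then 1 else 0))"
    by (intro sum.cong) (auto simp: sign_def)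
  also have "\<dots> = real n - 2 * real (weight w)"
    by (simp add: sum_subtractf sum.If_cases wt flip: sum_distrib_left)
  finally show "(\<Sum>i<n. sign (w ! i)) = real n - 2 * real (weight w)" .
qed

text \<open>The complement changes the factor of each coordinate in the support of \<open>w\<close>, so its sign
  depends only on the parity of the weight.\<close>

lemma character_complement:
  assumes "x \<in> words n" "w \<in> words n"
  shows "character n w (word_add x (all_one n)) = (-1) ^ weight w * character n w x"
proof -
  have "character n w (word_add x (all_one n)) = (\<Prod>i<n. sign (w ! i) * sign (w ! i * x ! i))"
    unfolding character_def using assms(1)
    by (intro prod.cong) (auto simp: nth_complement distrib_left sign_add)
  then show ?thesis
    using prod_sign[OF assms(2)] by (simp add: prod.distrib character_def)
qed

lemma ball_sum_character:
  assumes "x \<in> words n" "w \<in> words n"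
  shows "ball_sum n (character n w) x = (real n + 1 - 2 * real (weight w)) * character n w x"
proof -
  have "ball_sum n (character n w) x = character n w x + (\<Sum>i<n. sign (w ! i)) * character n w x"
    using assms(1) by (simp add: ball_sum_def character_flip sum_distrib_right)
  then show ?thesis by (simp add: sum_sign[OF assms(2)] algebra_simps)
qed

lemma character_orthogonal:
  assumes "x \<in> words n" "y \<in> words n"
  shows "(\<Sum>w\<in>words n. character n w x * character n w y) = (if x = y then 2 ^ n else 0)"
proof (cases "x = y")
  case True
  then show ?thesis by (simp add: card_words)
next
  case False
  then obtain i where i: "i < n" "x ! i \<noteq> y ! i"
    using assms by (auto simp: words_def list_eq_iff_nth_eq)
  then have sg: "sign (x ! i) * sign (y ! i) = -1"
    by (cases "x ! i"; cases "y ! i") (auto simp: sign_def)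
  let ?S = "\<Sum>w\<in>words n. character n w x * character n w y"
  \<comment> \<open>Flipping coordinate \<open>i\<close> of \<open>w\<close>, where \<open>x\<close> and \<open>y\<close> differ, negates every summand.\<close>
  have bij: "bij_betw (flip i) (words n) (words n)"
    by (rule bij_betw_byWitness[where f' = "flip i"]) auto
  have "?S = (\<Sum>w\<in>words n. character n (flip i w) x * character n (flip i w) y)"
    by (rule sum.reindex_bij_betw[OF bij, symmetric])
  also have "\<dots> = (\<Sum>w\<in>words n. (sign (x ! i) * sign (y ! i)) * (character n w x * character n w y))"
    using i(1) by (intro sum.cong)
      (auto simp: character_commute[of n _ x] character_commute[of n _ y] character_flip)
  also have "\<dots> = - ?S" by (simp add: sg sum_negf)
  finally show ?thesis using False by simp
qed

text \<open>Fourier inversion for the indicator of a set of words.\<close>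

lemma indicator_eq_character_sum:
  assumes "C \<subseteq> words n" "x \<in> words n"
  shows "indicator C x = (\<Sum>w\<in>words n. ((\<Sum>c\<in>C. character n w c) / 2 ^ n) * character n w x)"
proof -
  have fin: "finite C" by (rule finite_subset[OF assms(1) finite_words])
  have "(\<Sum>w\<in>words n. (\<Sum>c\<in>C. character n w c) * character n w x)
      = (\<Sum>c\<in>C. \<Sum>w\<in>words n. character n w c * character n w x)"
    by (subst sum.swap) (simp add: sum_distrib_right)
  also have "\<dots> = (\<Sum>c\<in>C. if c = x then 2 ^ n else 0)"
    using assms by (intro sum.cong refl character_orthogonal) auto
  also have "\<dots> = 2 ^ n * indicator C x"
    using fin by (simp add: indicator_def sum.delta')
  finally show ?thesis by (simp flip: sum_divide_distrib)
qed

text \<open>Operators that are diagonal on characters act on an expansion coefficientwise; this avoids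
  computing any Fourier transform other than that of the code.\<close>

lemma ball_sum_expansion:
  assumes "x \<in> words n"
    and "\<And>y. y \<in> words n \<Longrightarrow> f y = (\<Sum>w\<in>words n. a w * character n w y)"
  shows "ball_sum n f x
    = (\<Sum>w\<in>words n. (a w * (real n + 1 - 2 * real (weight w))) * character n w x)"
proof -
  have "ball_sum n f x = (\<Sum>w\<in>words n. a w * ball_sum n (character n w) x)"
    using assms
    by (simp add: ball_sum_def distrib_left sum.distrib sum_distrib_left sum.swap[of _ "words n"])
  also have "\<dots> = (\<Sum>w\<in>words n. (a w * (real n + 1 - 2 * real (weight w))) * character n w x)"
    using assms(1) by (intro sum.cong) (auto simp: ball_sum_character)
  finally show ?thesis .
qed

lemma complement_expansion:
  assumes "x \<in> words n"
    and "\<And>y. y \<in> words n \<Longrightarrow> f y = (\<Sum>w\<in>words n. a w * character n w y)"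
  shows "f (word_add x (all_one n)) = (\<Sum>w\<in>words n. (a w * (-1) ^ weight w) * character n w x)"
  using assms by (simp add: character_complement mult.assoc)

section \<open>Spectrum of a code with the parameters of a doubly shortened perfect code\<close>

text \<open>With \<open>n + 3 = 2\<^sup>m\<close>, the cardinality \<open>2\<^sup>n\<^sup>-\<^sup>m\<close> is \<open>2\<^sup>n / (n + 3)\<close>. This
  equation and the divisibility by 4 are all that the spectral argument uses of \<open>m\<close>.\<close>

locale doubly_shortened_perfect_code =
  fixes n :: nat and C :: "binary_word set"
  assumes four_dvd: "4 dvd n + 3"
    and code_subset: "C \<subseteq> words n"
    and card_code: "card C * (n + 3) = 2 ^ n"
    and code_distance: "\<And>x y. x \<in> C \<Longrightarrow> y \<in> C \<Longrightarrow> x \<noteq> y \<Longrightarrow> 3 \<le> hamming x y"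
begin

abbreviation code_ind :: "binary_word \<Rightarrow> real" where
  "code_ind \<equiv> indicator C"

abbreviation antipode_ind :: "binary_word \<Rightarrow> real" where
  "antipode_ind x \<equiv> code_ind (word_add x (all_one n))"

text \<open>Up to the factor \<open>2\<^sup>n\<close>, the Fourier coefficients of the indicator of the code.\<close>

definition coeff :: "binary_word \<Rightarrow> real" where
  "coeff w = (\<Sum>c\<in>C. character n w c)"

definition eigenvalue :: "binary_word \<Rightarrow> real" where
  "eigenvalue w = real n + 1 - 2 * real (weight w)"

text \<open>The eigenvalue of \<open>T\<^sup>2 - 2 - 2 P\<close> on the character of \<open>w\<close>. It is the polynomial of the linear
  programming bound: besides the trivial character, the code involves only characters on which it
  vanishes.\<close>

definition defect :: "binary_word \<Rightarrow> real" where
  "defect w = eigenvalue w ^ 2 - 2 - 2 * (-1) ^ weight w"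

lemma finite_code: "finite C"
  by (rule finite_subset[OF code_subset finite_words])

lemma code_in_words: "c \<in> C \<Longrightarrow> c \<in> words n"
  using code_subset by auto

text \<open>Two points of a ball of radius 1 have distance at most 2, so a ball contains at most one codeword.\<close>

lemma ball_sum_code_le_1:
  assumes "x \<in> words n"
  shows "ball_sum n code_ind x \<le> 1"
proof -
  have one: "c = c'" if "c \<in> C" "c' \<in> C" "hamming c c' \<le> 2" for c c'
    using code_distance[OF that(1,2)] that(3) by fastforce
  have le: "real (card {y \<in> C. hypercube_adj n x y}) \<le> 1"
  proof -
    have "card {y \<in> C. hypercube_adj n x y} \<le> Suc 0"
      using one hamming_flip_flip_le finite_code
      by (subst card_le_Suc0_iff_eq) (auto simp: neighbours_eq[OF assms])
    then show ?thesis by simp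
  qed
  show ?thesis
  proof (cases "x \<in> C")
    case True
    have "y \<notin> C" if "hypercube_adj n x y" for y
      using code_distance[OF True, of y] that hamming_eq_0_iff[of x n y]
      by (fastforce simp: hypercube_adj_def)
    then have none: "{y \<in> C. hypercube_adj n x y} = {}" by auto
    show ?thesis unfolding ball_sum_indicator[OF assms] none by simp
  next
    case False
    then show ?thesis using le by (simp add: ball_sum_indicator[OF assms])
  qed
qed

lemma ball_sum_code_eq_1:
  assumes "x \<in> words n" "x \<in> C \<or> (\<exists>c\<in>C. hypercube_adj n x c)"
  shows "ball_sum n code_ind x = 1"
proof -
  have "1 \<le> ball_sum n code_ind x"
  proof (cases "x \<in> C")
    case True
    then show ?thesis by (simp add: ball_sum_indicator[OF assms(1)])
  next
    case False
    then have "{y \<in> C. hypercube_adj n x y} \<noteq> {}" using assms(2) by auto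
    then have "0 < card {y \<in> C. hypercube_adj n x y}" using finite_code by (simp add: card_gt_0_iff)
    then show ?thesis using False by (simp add: ball_sum_indicator[OF assms(1)])
  qed
  then show ?thesis using ball_sum_code_le_1[OF assms(1)] by simp
qed

text \<open>Each of the \<open>n + 1\<close> points of the ball around \<open>c\<close> has exactly one codeword, namely \<open>c\<close>, within
  distance 1.\<close>

lemma ball_sum_twice_codeword:
  assumes "c \<in> C"
  shows "ball_sum n (ball_sum n code_ind) c = real n + 1"
proof -
  have c: "c \<in> words n" by (rule code_in_words[OF assms])
  have "ball_sum n code_ind (flip i c) = 1" if "i < n" for i
  proof (rule ball_sum_code_eq_1)
    have "\<exists>j<n. c = flip j (flip i c)" using that flip_flip[of i c] by metis
    then have "hypercube_adj n (flip i c) c"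
      using c hamming_eq_1_iff[of "flip i c" n c] by (auto simp: hypercube_adj_def)
    then show "flip i c \<in> C \<or> (\<exists>c'\<in>C. hypercube_adj n (flip i c) c')" using assms by blast
  qed (simp add: c)
  then show ?thesis
    using ball_sum_code_eq_1[OF c] assms by (simp add: ball_sum_def[of n "ball_sum n code_ind"])
qed

lemma code_ind_expansion:
  "x \<in> words n \<Longrightarrow> code_ind x = (\<Sum>w\<in>words n. coeff w / 2 ^ n * character n w x)"
  unfolding coeff_def by (rule indicator_eq_character_sum[OF code_subset])

lemma ball_sum_code_ind_expansion:
  "x \<in> words n \<Longrightarrow>
    ball_sum n code_ind x = (\<Sum>w\<in>words n. coeff w / 2 ^ n * eigenvalue w * character n w x)"
  unfolding eigenvalue_def by (rule ball_sum_expansion[OF _ code_ind_expansion])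

lemma defect_expansion:
  assumes "x \<in> words n"
  shows "ball_sum n (ball_sum n code_ind) x - 2 * code_ind x - 2 * antipode_ind x
    = (\<Sum>w\<in>words n. coeff w / 2 ^ n * defect w * character n w x)"
proof -
  have "ball_sum n (ball_sum n code_ind) x
      = (\<Sum>w\<in>words n. coeff w / 2 ^ n * eigenvalue w * eigenvalue w * character n w x)"
    unfolding eigenvalue_def[of w for w]
    by (rule ball_sum_expansion[OF assms]) (simp add: ball_sum_code_ind_expansion eigenvalue_def)
  then show ?thesis
    using code_ind_expansion[OF assms] complement_expansion[OF assms code_ind_expansion]
    by (simp add: defect_def power2_eq_square algebra_simps sum_subtractf sum_distrib_left
        flip: sum.distrib)
qed

text \<open>For odd weight the defect is the square of the eigenvalue. For even weight it is that square
  minus 4, and the eigenvalue is twice an odd number because 4 divides \<open>n + 3\<close>.\<close>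

lemma defect_nonneg: "0 \<le> defect w"
proof (cases "even (weight w)")
  case True
  obtain k j where k: "n + 3 = 4 * k" and j: "weight w = 2 * j"
    using four_dvd True by (auto elim!: dvdE)
  \<comment> \<open>Half the eigenvalue, an odd integer and hence nonzero.\<close>
  define t :: int where "t = 2 * int k - 1 - 2 * int j"
  have "1 \<le> t ^ 2"
  proof -
    have "t \<noteq> 0" unfolding t_def by presburger
    then show ?thesis by (simp add: int_one_le_iff_zero_less)
  qed
  moreover have "real n = 4 * real k - 3"
    using k by linarith
  then have "eigenvalue w = 2 * real_of_int t"
    using j by (simp add: eigenvalue_def t_def)
  moreover have "1 \<le> (real_of_int t) ^ 2"
    using \<open>1 \<le> t ^ 2\<close> by (metis of_int_1_le_iff of_int_power)
  ultimately show ?thesis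
    using True by (simp add: defect_def power_mult_distrib)
qed (simp add: defect_def)

definition zero_word :: binary_word where
  "zero_word = replicate n 0"

lemma zero_word_in_words: "zero_word \<in> words n"
  by (simp add: zero_word_def words_def)

lemma character_zero_word: "character n zero_word x = 1"
  by (simp add: character_def zero_word_def sign_def)

lemma weight_zero_word: "weight zero_word = 0"
  by (simp add: weight_def zero_word_def)

text \<open>The contribution of the trivial character. Here the cardinality of the code enters: it makes
  this contribution equal to the upper bound \<open>n - 1\<close> for \<open>T\<^sup>2 f - 2 f - 2 P f\<close> on codewords.\<close>

lemma coeff_zero_word: "coeff zero_word / 2 ^ n * defect zero_word = real n - 1"
proof -
  have "real (card C) * (real n + 3) = 2 ^ n"
    using arg_cong[OF card_code, of real] by simp
  moreover have "defect zero_word = (real n + 3) * (real n - 1)"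
    by (simp add: defect_def eigenvalue_def weight_zero_word power2_eq_square algebra_simps)
  moreover have "coeff zero_word = real (card C)"
    by (simp add: coeff_def character_zero_word)
  ultimately have "coeff zero_word * defect zero_word = 2 ^ n * (real n - 1)"
    by (metis mult.assoc)
  then show ?thesis by simp
qed

lemma sum_remove_zero_word:
  "(\<Sum>w\<in>words n. h w) = h zero_word + (\<Sum>w\<in>words n - {zero_word}. h w)" for h :: "_ \<Rightarrow> real"
  by (rule sum.remove) (simp_all add: zero_word_in_words)

text \<open>Summing \<open>T\<^sup>2 f - 2 f - 2 P f\<close> over the code gives a combination of the nonnegative defects with
  weights \<open>(coeff w)\<^sup>2 / 2\<^sup>n\<close>. The sum is at most \<open>\<bar>C\<bar> (n - 1)\<close>, which is the term of the zero word
  alone, so every other term is zero.\<close>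

lemma spectral_support:
  assumes "w \<in> words n" "w \<noteq> zero_word"
  shows "coeff w * defect w = 0"
proof -
  have "(\<Sum>w\<in>words n. coeff w ^ 2 / 2 ^ n * defect w)
      = (\<Sum>w\<in>words n. \<Sum>c\<in>C. coeff w / 2 ^ n * defect w * character n w c)"
    unfolding sum_distrib_left[symmetric] coeff_def[symmetric]
    by (simp add: power2_eq_square mult_ac)
  also have "\<dots> = (\<Sum>c\<in>C. \<Sum>w\<in>words n. coeff w / 2 ^ n * defect w * character n w c)"
    by (rule sum.swap)
  also have "\<dots> = (\<Sum>c\<in>C. ball_sum n (ball_sum n code_ind) c - 2 * code_ind c - 2 * antipode_ind c)"
    by (intro sum.cong refl defect_expansion[symmetric] code_in_words)
  \<comment> \<open>At a codeword the value is \<open>(n + 1) - 2 - 2 P f\<close>, and \<open>P f\<close> is nonnegative.\<close>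
  also have "\<dots> \<le> (\<Sum>c\<in>C. real n - 1)"
    by (intro sum_mono) (auto simp: ball_sum_twice_codeword)
  also have "\<dots> = coeff zero_word * (coeff zero_word / 2 ^ n * defect zero_word)"
    unfolding coeff_zero_word by (simp add: coeff_def character_zero_word)
  also have "\<dots> = coeff zero_word ^ 2 / 2 ^ n * defect zero_word"
    by (simp add: power2_eq_square)
  finally have le: "(\<Sum>w\<in>words n - {zero_word}. coeff w ^ 2 / 2 ^ n * defect w) \<le> 0"
    unfolding sum_remove_zero_word by simp
  have nonneg: "\<forall>w\<in>words n - {zero_word}. 0 \<le> coeff w ^ 2 / 2 ^ n * defect w"
    by (simp add: defect_nonneg)
  have "(\<Sum>w\<in>words n - {zero_word}. coeff w ^ 2 / 2 ^ n * defect w) = 0"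
    using le nonneg by (intro antisym sum_nonneg) auto
  then have "coeff w ^ 2 / 2 ^ n * defect w = 0"
    using nonneg assms by (subst (asm) sum_nonneg_eq_0_iff) auto
  then show ?thesis by auto
qed

text \<open>By \<open>spectral_support\<close> only the constant term of the expansion of \<open>T\<^sup>2 f - 2 f - 2 P f\<close> survives.\<close>

lemma ball_sum_twice:
  assumes "x \<in> words n"
  shows "ball_sum n (ball_sum n code_ind) x = 2 * code_ind x + 2 * antipode_ind x + (real n - 1)"
proof -
  have "(\<Sum>w\<in>words n - {zero_word}. coeff w / 2 ^ n * defect w * character n w x) = 0"
    using spectral_support by (intro sum.neutral) auto
  then show ?thesis
    using defect_expansion[OF assms] coeff_zero_word
    unfolding sum_remove_zero_word by (simp add: character_zero_word)
qed

text \<open>The operators \<open>T P\<close> and \<open>T\<close> differ only on characters of odd weight, and among these the code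
  involves only those with defect zero, that is, those killed by \<open>T\<close>.\<close>

lemma ball_sum_complement:
  assumes "x \<in> words n"
  shows "ball_sum n antipode_ind x = ball_sum n code_ind x"
proof -
  have "ball_sum n antipode_ind x
      = (\<Sum>w\<in>words n. coeff w / 2 ^ n * (-1) ^ weight w * eigenvalue w * character n w x)"
    unfolding eigenvalue_def
    by (rule ball_sum_expansion[OF assms]) (rule complement_expansion[OF _ code_ind_expansion])
  also have "\<dots> = (\<Sum>w\<in>words n. coeff w / 2 ^ n * eigenvalue w * character n w x)"
  proof (intro sum.cong refl)
    fix w assume w: "w \<in> words n"
    consider "even (weight w)" | "coeff w = 0" | "odd (weight w)" "defect w = 0"
      using spectral_support[OF w] weight_zero_word by (cases "w = zero_word") auto
    then show "coeff w / 2 ^ n * (-1) ^ weight w * eigenvalue w * character n w x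
        = coeff w / 2 ^ n * eigenvalue w * character n w x"
      by cases (auto simp: defect_def)
  qed
  also have "\<dots> = ball_sum n code_ind x" by (rule ball_sum_code_ind_expansion[OF assms, symmetric])
  finally show ?thesis .
qed

end

section \<open>The equitable partition\<close>

theorem theorem1:
  fixes m n :: nat and C1 C2 C3 C4 :: "binary_word set"
  assumes "3 \<le> m"
    and "n = 2 ^ m - 3"
    and "is_code n (2 ^ (n - m)) 3 C1"
    and "C2 = {x \<in> words n. word_add x (all_one n) \<in> C1}"
    and "C3 = {x \<in> words n. dist_to_code x C1 = 1} - C2"
    and "C4 = words n - (C1 \<union> C2 \<union> C3)"
  shows "partition_on (words n) {C1, C2, C3, C4} \<and>
    equitable_partition (words n) (hypercube_adj n) [C1, C2, C3, C4]
      [[0, 1, n - 1, 0],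
       [1, 0, n - 1, 0],
       [1, 1, n - 4, 2],
       [0, 0, n - 1, 1]]"
proof -
  have pow: "2 ^ m = 8 * (2 :: nat) ^ (m - 3)"
    using assms(1) power_add[of "2 :: nat" 3 "m - 3"] by simp
  have "8 \<le> (2 :: nat) ^ m"
    unfolding pow by simp
  then have n3: "n + 3 = 2 ^ m" and n5: "5 \<le> n"
    using assms(2) by simp_all
  have "m \<le> n"
  proof -
    have "k + 3 \<le> 8 * 2 ^ k - 3" for k :: nat
      by (induction k) auto
    from this[of "m - 3"] show ?thesis using assms(1,2) pow by simp
  qed
  interpret doubly_shortened_perfect_code n C1
  proof
    show "4 dvd n + 3" unfolding n3 pow by simp
    show "C1 \<subseteq> words n" using assms(3) by (simp add: is_code_def)
    show "card C1 * (n + 3) = 2 ^ n"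
      using assms(3) \<open>m \<le> n\<close> unfolding n3 is_code_def by (simp flip: power_add)
    show "3 \<le> hamming x y" if "x \<in> C1" "y \<in> C1" "x \<noteq> y" for x y
      using assms(3) that by (simp add: is_code_def)
  qed
  define nb where "nb S x = real (card {y \<in> S. hypercube_adj n x y})" for S x
  have nb: "ball_sum n (indicator S) x = indicator S x + nb S x" if "x \<in> words n" for S x
    unfolding nb_def by (rule ball_sum_indicator[OF that])
  have C2_ind: "indicator C2 x = antipode_ind x" if "x \<in> words n" for x
    using that by (simp add: assms(4) indicator_def)
  have C1_nonempty: "C1 \<noteq> {}"
    using card_code by auto
  have subs: "C1 \<subseteq> words n" "C2 \<subseteq> words n" "C3 \<subseteq> words n" "C4 \<subseteq> words n"
    using code_subset assms(4-6) by auto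

  \<comment> \<open>At a common point of \<open>C1\<close> and \<open>C2\<close> the value of \<open>T\<^sup>2 f\<close> would be both \<open>n + 1\<close> and \<open>n + 3\<close>.\<close>
  have C12: "x \<notin> C2" if "x \<in> C1" for x
  proof
    assume "x \<in> C2"
    moreover have x: "x \<in> words n" using that by (rule code_in_words)
    ultimately have "antipode_ind x = 1" using C2_ind[OF x] by simp
    then show False
      using ball_sum_twice[OF x] ball_sum_twice_codeword[OF that] that by simp
  qed
  have ball_C2: "ball_sum n (indicator C2) x = ball_sum n code_ind x" if "x \<in> words n" for x
    using ball_sum_cong[OF that C2_ind] ball_sum_complement[OF that] by simp
  have ball_01: "ball_sum n code_ind x = 0 \<or> ball_sum n code_ind x = 1" if "x \<in> words n" for x
  proof -
    define k where "k = (if x \<in> C1 then 1 else 0) + card {y \<in> C1. hypercube_adj n x y}"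
    have k: "ball_sum n code_ind x = real k"
      by (simp add: k_def ball_sum_indicator[OF that])
    then have "k \<le> 1"
      using ball_sum_code_le_1[OF that] by simp
    then show ?thesis
      unfolding k by (cases k) auto
  qed
  have dist_1: "dist_to_code x C1 = 1 \<longleftrightarrow> nb C1 x \<noteq> 0 \<and> x \<notin> C1" if x: "x \<in> words n" for x
  proof -
    have fin: "finite (hamming x ` C1)" "hamming x ` C1 \<noteq> {}"
      using finite_code C1_nonempty by auto
    have "dist_to_code x C1 = 1 \<longleftrightarrow> (1 \<in> hamming x ` C1 \<and> (\<forall>c\<in>C1. 1 \<le> hamming x c))"
      unfolding dist_to_code_def using Min_eq_iff[OF fin] by auto
    also have "1 \<in> hamming x ` C1 \<longleftrightarrow> {y \<in> C1. hypercube_adj n x y} \<noteq> {}"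
      using x code_in_words by (force simp: hypercube_adj_def image_iff)
    also have "\<dots> \<longleftrightarrow> nb C1 x \<noteq> 0"
      using finite_code by (simp add: nb_def)
    also have "(\<forall>c\<in>C1. 1 \<le> hamming x c) \<longleftrightarrow> x \<notin> C1"
      using hamming_eq_0_iff[OF x code_in_words] x
      by (metis One_nat_def Suc_leI hamming_eq_0_iff neq0_conv not_one_le_zero)
    finally show ?thesis .
  qed
  have C3_iff: "x \<in> C3 \<longleftrightarrow> ball_sum n code_ind x = 1 \<and> x \<notin> C1 \<and> x \<notin> C2" if "x \<in> words n" for x
    using dist_1[OF that] nb[OF that, of C1] ball_01[OF that] that
    by (auto simp: assms(5) indicator_def split: if_splits)
  have ball_1_C12: "ball_sum n code_ind x = 1" if "x \<in> C1 \<union> C2" for x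
  proof -
    have x: "x \<in> words n" using that subs by auto
    have "ball_sum n code_ind x \<noteq> 0"
    proof (cases "x \<in> C1")
      case True
      then show ?thesis using nb[OF x, of C1] by (simp add: nb_def)
    next
      case False
      then show ?thesis using that nb[OF x, of C2] ball_C2[OF x] by (simp add: nb_def)
    qed
    then show ?thesis using ball_01[OF x] by simp
  qed
  \<comment> \<open>The balls around \<open>C1\<close> cover \<open>C2\<close> too, because \<open>T (P f) = T f\<close>; what they miss is \<open>C4\<close>.\<close>
  have C4_iff: "x \<in> C4 \<longleftrightarrow> ball_sum n code_ind x = 0" if "x \<in> words n" for x
    using C3_iff[OF that] ball_1_C12 ball_01[OF that] that by (auto simp: assms(6))
  have C4_ind: "indicator C4 x = 1 - ball_sum n code_ind x" if "x \<in> words n" for x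
    using C4_iff[OF that] ball_01[OF that] by (auto simp: indicator_def)

  \<comment> \<open>Neighbour counts in terms of \<open>f\<close>, \<open>P f\<close> and \<open>T f\<close>, all of which are constant on each part.\<close>
  have nb1: "nb C1 x = ball_sum n code_ind x - indicator C1 x" if "x \<in> words n" for x
    using nb[OF that] by simp
  have nb2: "nb C2 x = ball_sum n code_ind x - indicator C2 x" if "x \<in> words n" for x
    using nb[OF that, of C2] ball_C2[OF that] by simp
  have nb4: "nb C4 x = 1 + ball_sum n code_ind x - 2 * indicator C1 x - 2 * indicator C2 x"
    if "x \<in> words n" for x
  proof -
    have "ball_sum n (indicator C4) x = ball_sum n (\<lambda>y. 1 - ball_sum n code_ind y) x"
      by (rule ball_sum_cong[OF that C4_ind])
    also have "\<dots> = real n + 1 - ball_sum n (ball_sum n code_ind) x"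
      by (simp add: ball_sum_def[of n "\<lambda>y. 1 - ball_sum n code_ind y"]
        ball_sum_def[of n "ball_sum n code_ind"] sum_subtractf)
    finally show ?thesis
      using nb[OF that, of C4] ball_sum_twice[OF that] C4_ind[OF that] C2_ind[OF that] by simp
  qed
  have nb3: "nb C3 x = real n - nb C1 x - nb C2 x - nb C4 x" if "x \<in> words n" for x
  proof -
    have one: "(1 :: real) = indicator C1 y + indicator C2 y + indicator C3 y + indicator C4 y"
      if "y \<in> words n" for y
      using C12[of y] C3_iff[OF that] C4_iff[OF that] ball_1_C12[of y] ball_01[OF that]
      by (auto simp: indicator_def)
    have "real n = (\<Sum>i<n. 1)" by simp
    also have "\<dots> = (\<Sum>i<n. indicator C1 (flip i x) + indicator C2 (flip i x)
        + indicator C3 (flip i x) + indicator C4 (flip i x))"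
      using that by (intro sum.cong one) auto
    also have "\<dots> = nb C1 x + nb C2 x + nb C3 x + nb C4 x"
      by (simp add: sum.distrib nb_def card_neighbours[OF that])
    finally show ?thesis by simp
  qed
  note nbs = nb1 nb2 nb3 nb4

  let ?Cs = "[C1, C2, C3, C4]"
  let ?S = "[[0, 1, n - 1, 0], [1, 0, n - 1, 0], [1, 1, n - 4, 2], [0, 0, n - 1, 1 :: nat]]"
  have row1: "nb C1 x = 0" "nb C2 x = 1" "nb C3 x = real (n - 1)" "nb C4 x = 0"
    if "x \<in> C1" for x
    using that subs n5 C12[OF that] ball_1_C12[of x] by (auto simp: nbs[of x] subsetD of_nat_diff)
  have row2: "nb C1 x = 1" "nb C2 x = 0" "nb C3 x = real (n - 1)" "nb C4 x = 0"
    if "x \<in> C2" for x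
    using that subs n5 C12[of x] ball_1_C12[of x]
    by (auto simp: nbs[of x] subsetD of_nat_diff indicator_def)
  have row3: "nb C1 x = 1" "nb C2 x = 1" "nb C3 x = real (n - 4)" "nb C4 x = 2"
    if "x \<in> C3" for x
    using that subs n5 C3_iff[of x] by (auto simp: nbs[of x] subsetD of_nat_diff indicator_def)
  have row4: "nb C1 x = 0" "nb C2 x = 0" "nb C3 x = real (n - 1)" "nb C4 x = 1"
    if "x \<in> C4" for x
  proof -
    have "x \<in> words n" "ball_sum n code_ind x = 0" "x \<notin> C1" "x \<notin> C2"
      using that subs C4_iff[of x] assms(6) by auto
    then show "nb C1 x = 0" "nb C2 x = 0" "nb C3 x = real (n - 1)" "nb C4 x = 1"
      using n5 by (auto simp: nbs of_nat_diff)
  qed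

  have inhabited: "S \<noteq> {}" if "nb S x \<noteq> 0" for S x
    using that by (auto simp: nb_def)
  obtain x1 where "x1 \<in> C1" using C1_nonempty by auto
  then have "C2 \<noteq> {}" "C3 \<noteq> {}"
    using row1[of x1] n5 by (auto intro!: inhabited[of _ x1])
  then obtain x3 where "x3 \<in> C3" by auto
  then have "C4 \<noteq> {}"
    using row3[of x3] by (auto intro!: inhabited[of _ x3])
  have disj: "C1 \<inter> C2 = {}" "C1 \<inter> C3 = {}" "C1 \<inter> C4 = {}" "C2 \<inter> C3 = {}" "C2 \<inter> C4 = {}" "C3 \<inter> C4 = {}"
    using C12 C3_iff subs(3) assms(6) by auto
  have part: "partition_on (words n) {C1, C2, C3, C4}"
    using C1_nonempty \<open>C2 \<noteq> {}\<close> \<open>C3 \<noteq> {}\<close> \<open>C4 \<noteq> {}\<close> disj subs assms(6)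
    by (auto simp: partition_on_def disjoint_def)
  have "distinct ?Cs"
    using C1_nonempty \<open>C2 \<noteq> {}\<close> \<open>C3 \<noteq> {}\<close> disj by auto
  moreover have "card {y \<in> ?Cs ! j. hypercube_adj n x y} = ?S ! i ! j"
    if "i < 4" "j < 4" "x \<in> ?Cs ! i" for i j x
  proof -
    have "i \<in> {0, 1, 2, 3}" "j \<in> {0, 1, 2, 3}" using that(1,2) by auto
    then have "nb (?Cs ! j) x = real (?S ! i ! j)"
      using that(3) by (auto simp: row1 row2 row3 row4)
    then show ?thesis by (simp only: nb_def of_nat_eq_iff)
  qed
  ultimately show ?thesis
    using part by (simp add: equitable_partition_def)
qed

end
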